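(* Let $n\geq 0$ be an integer, let $\theta\in\mathbb{R}$, and let $\gamma\notin\{0,-1,-2,\dots\}$. Then $$Hl\left(\tfrac12,-2n\theta;-2n,2\theta;\gamma,\gamma;x\right)=\sum_{k=0}^n 4^k\binom{n}{k}\frac{(\theta)_k}{(\gamma)_k}(x^2-x)^k .$$
   Context: For parameters with $a\notin\{0,1\}$, $\gamma\notin\{0,-1,-2,\dots\}$, and $\epsilon$ determined by $\alpha+\beta+1=\gamma+\delta+\epsilon$, the (local) Heun function $Hl(a,q;\alpha,\beta;\gamma,\delta;x)$ is the solution $u(x)$, analytic at $x=0$ and normalized by $u(0)=1$, of the general Heun equation $$u''(x)+\left(\frac{\gamma}{x}+\frac{\delta}{x-1}+\frac{\epsilon}{x-a}\right)u'(x)+\frac{\alpha\beta x-q}{x(x-1)(x-a)}u(x)=0 .$$ For an integer $k\ge 0$ and a number $r$, $(r)_k:=r(r+1)\cdots(r+k-1)$ if $k>0$, and $(r)_0:=1$. *)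

theory Defs
  imports "HOL-Analysis.Analysis"
begin

text \<open>
  The parameter \<open>\<epsilon>\<close> of the general Heun equation is not independent: it is given by
  \<open>\<alpha> + \<beta> + 1 = \<gamma> + \<delta> + \<epsilon>\<close>.
\<close>

definition heun_epsilon :: "complex \<Rightarrow> complex \<Rightarrow> complex \<Rightarrow> complex \<Rightarrow> complex" where
  "heun_epsilon \<alpha> \<beta> \<gamma> \<delta> = \<alpha> + \<beta> + 1 - \<gamma> - \<delta>"

definition heun_equation_at ::
  "complex \<Rightarrow> complex \<Rightarrow> complex \<Rightarrow> complex \<Rightarrow> complex \<Rightarrow> complex \<Rightarrow>
   (complex \<Rightarrow> complex) \<Rightarrow> complex \<Rightarrow> bool" where
  "heun_equation_at a q \<alpha> \<beta> \<gamma> \<delta> u x \<longleftrightarrow>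
     deriv (deriv u) x
     + (\<gamma> / x + \<delta> / (x - 1) + heun_epsilon \<alpha> \<beta> \<gamma> \<delta> / (x - a)) * deriv u x
     + (\<alpha> * \<beta> * x - q) / (x * (x - 1) * (x - a)) * u x = 0"

text \<open>
  The equation is singular at \<open>0\<close>, so it is imposed on a punctured neighbourhood of \<open>0\<close>.
\<close>

definition local_heun_solution ::
  "complex \<Rightarrow> complex \<Rightarrow> complex \<Rightarrow> complex \<Rightarrow> complex \<Rightarrow> complex \<Rightarrow>
   (complex \<Rightarrow> complex) \<Rightarrow> bool" where
  "local_heun_solution a q \<alpha> \<beta> \<gamma> \<delta> u \<longleftrightarrow>
     u analytic_on {0} \<and> u 0 = 1 \<and>
     (\<forall>\<^sub>F x in at 0. heun_equation_at a q \<alpha> \<beta> \<gamma> \<delta> u x)"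

text \<open>
  For \<open>a \<notin> {0, 1}\<close> and \<open>\<gamma> \<notin> \<int>\<^sub>\<le>\<^sub>0\<close> the normalized analytic solution is unique only as a germ
  at \<open>0\<close>. Hence its power series, rather than a function on the whole plane, is what the
  description operator picks out. The value at \<open>x\<close> is the sum of that series; it is meaningful
  wherever the series converges (which is the whole plane if the solution is a polynomial).
\<close>

definition Hl ::
  "complex \<Rightarrow> complex \<Rightarrow> complex \<Rightarrow> complex \<Rightarrow> complex \<Rightarrow> complex \<Rightarrow> complex \<Rightarrow> complex" where
  "Hl a q \<alpha> \<beta> \<gamma> \<delta> x =
     eval_fps (THE F. \<exists>u. local_heun_solution a q \<alpha> \<beta> \<gamma> \<delta> u \<and> u has_fps_expansion F) x"

end

theory Submission
  imports Defs "HOL-Complex_Analysis.Laurent_Convergence"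
begin

text \<open>
  Two facts give the formula: the right-hand side is a normalized analytic solution of the Heun
  equation at \<open>0\<close>, and the power series of such a solution is unique.

  For the first, put \<open>y = x\<^sup>2 - x\<close>, so that \<open>(2x - 1)\<^sup>2 = 4y + 1\<close>. With \<open>a = 1/2\<close>, \<open>\<delta> = \<gamma>\<close>,
  \<open>\<alpha> = - 2n\<close>, \<open>\<beta> = 2\<theta>\<close> the numerator \<open>\<alpha>\<beta>x - q\<close> is \<open>- 4n\<theta>(x - 1/2)\<close>, which cancels the factor
  \<open>x - a\<close>, and for \<open>u(x) = f(y)\<close> the Heun equation turns into the hypergeometric equation
  \<open>y(4y + 1) f'' + (\<gamma> + 4(\<theta> - n + 1)y) f' - 4n\<theta> f = 0\<close>. On coefficients this reads
  \<open>(k + 1)(\<gamma> + k) c\<^sub>k\<^sub>+\<^sub>1 = 4(n - k)(\<theta> + k) c\<^sub>k\<close> (lemma \<open>coeff_heun_reduced_poly_Suc\<close>), which the terminating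
  sequence \<open>4\<^sup>k (n choose k) (\<theta>)\<^sub>k / (\<gamma>)\<^sub>k\<close> satisfies. The transfer back to \<open>x\<close> is
  \<open>local_heun_solution_pcompose\<close>.

  For the second, the equation is multiplied by \<open>x(x - 1)(x - a)\<close> and read as a linear equation for
  formal power series. Its coefficient at \<open>x\<^sup>k\<close> contains the \<open>(k + 1)\<close>-st coefficient of the unknown
  series with the factor \<open>a(k + 1)(k + \<gamma>)\<close> and otherwise only earlier ones; that factor is nonzero,
  so the constant term determines the series (\<open>heun_fps_op_kernel\<close>,
  \<open>local_heun_solution_unique\<close>).
\<close>

section \<open>Uniqueness of the local Heun series\<close>

text \<open>
  The Heun operator, cleared of denominators by the factor \<open>x(x - 1)(x - a)\<close>, acting on formal
  power series.
\<close>

definition heun_fps_op ::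
  "complex \<Rightarrow> complex \<Rightarrow> complex \<Rightarrow> complex \<Rightarrow> complex \<Rightarrow> complex \<Rightarrow> complex fps \<Rightarrow> complex fps" where
  "heun_fps_op a q \<alpha> \<beta> \<gamma> \<delta> F =
     fps_X * (fps_X - fps_const 1) * (fps_X - fps_const a) * fps_deriv (fps_deriv F)
     + (fps_const \<gamma> * ((fps_X - fps_const 1) * (fps_X - fps_const a))
        + fps_const \<delta> * (fps_X * (fps_X - fps_const a))
        + fps_const (heun_epsilon \<alpha> \<beta> \<gamma> \<delta>) * (fps_X * (fps_X - fps_const 1))) * fps_deriv F
     + (fps_const (\<alpha> * \<beta>) * fps_X - fps_const q) * F"

lemma heun_fps_op_diff:
  "heun_fps_op a q \<alpha> \<beta> \<gamma> \<delta> (F - G) = heun_fps_op a q \<alpha> \<beta> \<gamma> \<delta> F - heun_fps_op a q \<alpha> \<beta> \<gamma> \<delta> G"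
proof -
  have lin: "A * (x - x') + B * (y - y') + C * (z - z') =
             A * x + B * y + C * z - (A * x' + B * y' + C * z')"
    for A B C x x' y y' z z' :: "complex fps" by (simp add: algebra_simps)
  show ?thesis unfolding heun_fps_op_def by (simp only: fps_deriv_sub lin)
qed

lemma heun_fps_op_eq_0:
  assumes "local_heun_solution a q \<alpha> \<beta> \<gamma> \<delta> u" "u has_fps_expansion F"
  shows   "heun_fps_op a q \<alpha> \<beta> \<gamma> \<delta> F = 0"
proof -
  let ?L = "\<lambda>x. x * (x - 1) * (x - a) * deriv (deriv u) x
     + (\<gamma> * ((x - 1) * (x - a)) + \<delta> * (x * (x - a))
        + heun_epsilon \<alpha> \<beta> \<gamma> \<delta> * (x * (x - 1))) * deriv u x
     + (\<alpha> * \<beta> * x - q) * u x"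
  have "eventually (\<lambda>x::complex. x \<noteq> c) (at 0)" for c
    by (rule eventually_neq_at_within)
  then have ev: "eventually (\<lambda>x. x \<noteq> 0 \<and> x \<noteq> 1 \<and> x \<noteq> a \<and> heun_equation_at a q \<alpha> \<beta> \<gamma> \<delta> u x) (at 0)"
    using assms(1) unfolding local_heun_solution_def by (intro eventually_conj) auto
  have zero: "eventually (\<lambda>x. ?L x = 0) (at 0)"
    using ev
  proof eventually_elim
    case (elim x)
    have "?L x = x * (x - 1) * (x - a) *
        (deriv (deriv u) x
         + (\<gamma> / x + \<delta> / (x - 1) + heun_epsilon \<alpha> \<beta> \<gamma> \<delta> / (x - a)) * deriv u x
         + (\<alpha> * \<beta> * x - q) / (x * (x - 1) * (x - a)) * u x)"
    proof -
      have "x \<noteq> 0" "x - 1 \<noteq> 0" "x - a \<noteq> 0" using elim by auto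
      then show ?thesis by (simp add: divide_simps) (simp add: algebra_simps)
    qed
    with elim show ?case by (simp add: heun_equation_at_def)
  qed
  have "?L has_fps_expansion heun_fps_op a q \<alpha> \<beta> \<gamma> \<delta> F"
    unfolding heun_fps_op_def
    by (intro has_fps_expansion_add has_fps_expansion_diff has_fps_expansion_mult
        has_fps_expansion_const has_fps_expansion_fps_X has_fps_expansion_deriv assms(2))
  \<comment> \<open>Laurent expansions only involve a punctured neighbourhood, which is where the equation holds.\<close>
  then have "?L has_laurent_expansion fps_to_fls (heun_fps_op a q \<alpha> \<beta> \<gamma> \<delta> F)"
    by (rule has_laurent_expansion_fps)
  with zero show ?thesis
    using has_laurent_expansion_eventually_zero_iff by fastforce
qed

lemma heun_fps_op_nth_0:
  "fps_nth (heun_fps_op a q \<alpha> \<beta> \<gamma> \<delta> F) 0 = a * \<gamma> * fps_nth F 1 - q * fps_nth F 0"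
  unfolding heun_fps_op_def by simp

lemma heun_fps_op_nth_Suc:
  "fps_nth (heun_fps_op a q \<alpha> \<beta> \<gamma> \<delta> F) (Suc k) =
     a * of_nat (k + 2) * (of_nat (k + 1) + \<gamma>) * fps_nth F (k + 2)
     - ((of_nat (k + 1) * ((1 + a) * (of_nat k + \<gamma>) + a * \<delta> + heun_epsilon \<alpha> \<beta> \<gamma> \<delta>)) + q)
        * fps_nth F (k + 1)
     + (of_nat k * (of_nat k - 1 + \<gamma> + \<delta> + heun_epsilon \<alpha> \<beta> \<gamma> \<delta>) + \<alpha> * \<beta>) * fps_nth F k"
proof -
  define \<epsilon> where "\<epsilon> = heun_epsilon \<alpha> \<beta> \<gamma> \<delta>"
  have "heun_fps_op a q \<alpha> \<beta> \<gamma> \<delta> F =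
     fps_X * (fps_X * (fps_X * fps_deriv (fps_deriv F)))
     - fps_const (1 + a) * (fps_X * (fps_X * fps_deriv (fps_deriv F)))
     + fps_const a * (fps_X * fps_deriv (fps_deriv F))
     + fps_const (\<gamma> + \<delta> + \<epsilon>) * (fps_X * (fps_X * fps_deriv F))
     - fps_const (\<gamma> * (1 + a) + \<delta> * a + \<epsilon>) * (fps_X * fps_deriv F)
     + fps_const (\<gamma> * a) * fps_deriv F
     + fps_const (\<alpha> * \<beta>) * (fps_X * F) - fps_const q * F"
    unfolding heun_fps_op_def \<epsilon>_def[symmetric]
    by (simp add: algebra_simps flip: fps_const_add fps_const_mult)
  also have "fps_nth \<dots> (Suc k) =
     a * of_nat (k + 2) * (of_nat (k + 1) + \<gamma>) * fps_nth F (k + 2)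
     - ((of_nat (k + 1) * ((1 + a) * (of_nat k + \<gamma>) + a * \<delta> + \<epsilon>)) + q) * fps_nth F (k + 1)
     + (of_nat k * (of_nat k - 1 + \<gamma> + \<delta> + \<epsilon>) + \<alpha> * \<beta>) * fps_nth F k"
    by (cases k; simp; simp add: algebra_simps)
  finally show ?thesis unfolding \<epsilon>_def .
qed

text \<open>
  The local exponents at \<open>0\<close> are \<open>0\<close> and \<open>1 - \<gamma>\<close>. As \<open>1 - \<gamma>\<close> is not a positive integer, no
  nonzero power series without constant term is a solution.
\<close>

lemma heun_fps_op_kernel:
  assumes "a \<noteq> 0" "\<gamma> \<notin> \<int>\<^sub>\<le>\<^sub>0" "heun_fps_op a q \<alpha> \<beta> \<gamma> \<delta> F = 0" "fps_nth F 0 = 0"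
  shows   "F = 0"
proof -
  have \<gamma>: "of_nat k + \<gamma> \<noteq> 0" for k
    using assms(2) by (metis add_eq_0_iff plus_of_nat_eq_0_imp add.commute)
  have "fps_nth F k = 0" for k
  proof (induction k rule: less_induct)
    case (less k)
    consider "k = 0" | "k = 1" | m where "k = m + 2"
      by (metis One_nat_def add_2_eq_Suc' not0_implies_Suc)
    then show ?case
    proof cases
      case 2
      have "a * \<gamma> * fps_nth F 1 = 0"
        using heun_fps_op_nth_0[of a q \<alpha> \<beta> \<gamma> \<delta> F] assms by simp
      then show ?thesis using 2 assms(1) \<gamma>[of 0] by simp
    next
      case 3
      have "fps_nth F m = 0" "fps_nth F (m + 1) = 0" by (auto intro!: less.IH simp: 3)
      then have "a * of_nat (m + 2) * (of_nat (m + 1) + \<gamma>) * fps_nth F (m + 2) = 0"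
        using heun_fps_op_nth_Suc[of a q \<alpha> \<beta> \<gamma> \<delta> F m] assms(3) by simp
      moreover have "of_nat (m + 2) \<noteq> (0::complex)" by (subst of_nat_eq_0_iff) simp
      ultimately show ?thesis using 3 assms(1) \<gamma>[of "m + 1"] by auto
    qed (use assms(4) in simp)
  qed
  then show ?thesis by (simp add: fps_eq_iff)
qed

lemma local_heun_solution_unique:
  assumes "a \<noteq> 0" "\<gamma> \<notin> \<int>\<^sub>\<le>\<^sub>0"
  assumes u: "local_heun_solution a q \<alpha> \<beta> \<gamma> \<delta> u" "u has_fps_expansion F"
  assumes v: "local_heun_solution a q \<alpha> \<beta> \<gamma> \<delta> v" "v has_fps_expansion G"
  shows   "F = G"
proof -
  have "fps_nth F 0 = 1" "fps_nth G 0 = 1"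
    using u v has_fps_expansion_imp_0_eq_fps_nth_0
    by (fastforce simp: local_heun_solution_def)+
  then have "fps_nth (F - G) 0 = 0" by simp
  moreover have "heun_fps_op a q \<alpha> \<beta> \<gamma> \<delta> (F - G) = 0"
    by (simp only: heun_fps_op_diff heun_fps_op_eq_0[OF u] heun_fps_op_eq_0[OF v] diff_self)
  ultimately have "F - G = 0"
    using heun_fps_op_kernel[OF assms(1,2)] by blast
  then show ?thesis by simp
qed

text \<open>
  A polynomial equals the sum of its own expansion on the whole plane, so here the identification
  holds for every \<open>x\<close>, not only near \<open>0\<close>.
\<close>

lemma Hl_poly:
  assumes "a \<noteq> 0" "\<gamma> \<notin> \<int>\<^sub>\<le>\<^sub>0"
  assumes sol: "local_heun_solution a q \<alpha> \<beta> \<gamma> \<delta> (poly p)"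
  shows   "Hl a q \<alpha> \<beta> \<gamma> \<delta> x = poly p x"
proof -
  have exp: "poly p has_fps_expansion fps_of_poly p"
    by (simp add: has_fps_expansion_def)
  have "(THE F. \<exists>u. local_heun_solution a q \<alpha> \<beta> \<gamma> \<delta> u \<and> u has_fps_expansion F) = fps_of_poly p"
    using sol exp local_heun_solution_unique[OF assms(1,2)]
    by (intro the_equality) blast+
  then show ?thesis by (simp add: Hl_def)
qed

section \<open>The polynomial solution\<close>

text \<open>
  The right-hand side of the formula as a polynomial in \<open>y = x\<^sup>2 - x\<close>; it is the terminating
  hypergeometric sum \<open>\<^sub>2F\<^sub>1(- n, \<theta>; \<gamma>; - 4y)\<close>.
\<close>

definition heun_reduced_poly :: "nat \<Rightarrow> complex \<Rightarrow> complex \<Rightarrow> complex poly" where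
  "heun_reduced_poly n \<theta> \<gamma> =
     (\<Sum>k=0..n. monom (4 ^ k * of_nat (n choose k) * (pochhammer \<theta> k / pochhammer \<gamma> k)) k)"

lemma coeff_heun_reduced_poly:
  "coeff (heun_reduced_poly n \<theta> \<gamma>) k =
     4 ^ k * of_nat (n choose k) * (pochhammer \<theta> k / pochhammer \<gamma> k)"
  by (auto simp: heun_reduced_poly_def coeff_sum binomial_eq_0)

lemma coeff_heun_reduced_poly_Suc:
  assumes "\<gamma> \<notin> \<int>\<^sub>\<le>\<^sub>0"
  shows "of_nat (k + 1) * (\<gamma> + of_nat k) * coeff (heun_reduced_poly n \<theta> \<gamma>) (k + 1) =
           4 * (of_nat n - of_nat k) * (\<theta> + of_nat k) * coeff (heun_reduced_poly n \<theta> \<gamma>) k"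
proof -
  have binom: "of_nat (k + 1) * of_nat (n choose (k + 1)) =
               (of_nat n - of_nat k) * (of_nat (n choose k) :: complex)"
  proof (cases "k \<le> n")
    case True
    have "(k + 1) * (n choose (k + 1)) = (n - k) * (n choose k)"
      using binomial_absorption[of k n] binomial_absorb_comp[of n k] by simp
    then have "of_nat ((k + 1) * (n choose (k + 1))) = (of_nat ((n - k) * (n choose k)) :: complex)"
      by (rule arg_cong)
    with True show ?thesis by (simp only: of_nat_mult of_nat_diff)
  qed (simp add: binomial_eq_0)
  have nz: "\<gamma> + of_nat k \<noteq> 0" using assms by (metis plus_of_nat_eq_0_imp)
  have "of_nat (k + 1) * (\<gamma> + of_nat k) * coeff (heun_reduced_poly n \<theta> \<gamma>) (k + 1) =
     4 * 4 ^ k * (of_nat (k + 1) * of_nat (n choose (k + 1))) * pochhammer \<theta> (Suc k)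
     * ((\<gamma> + of_nat k) / pochhammer \<gamma> (Suc k))"
    by (simp add: coeff_heun_reduced_poly)
  also have "(\<gamma> + of_nat k) / pochhammer \<gamma> (Suc k) = 1 / pochhammer \<gamma> k"
    using nz by (simp add: pochhammer_Suc)
  finally show ?thesis unfolding binom by (simp add: coeff_heun_reduced_poly pochhammer_Suc)
qed

lemma heun_reduced_poly_ode:
  fixes n :: nat and \<theta> \<gamma> y :: complex
  assumes "\<gamma> \<notin> \<int>\<^sub>\<le>\<^sub>0"
  defines "f \<equiv> heun_reduced_poly n \<theta> \<gamma>"
  shows "y * (4 * y + 1) * poly (pderiv (pderiv f)) y
         + (\<gamma> + 4 * (\<theta> - of_nat n + 1) * y) * poly (pderiv f) y
         - 4 * of_nat n * \<theta> * poly f y = 0"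
proof -
  have "pCons 0 (pderiv (pderiv f)) + smult \<gamma> (pderiv f)
          + smult 4 (pCons 0 (pCons 0 (pderiv (pderiv f))))
          + smult (4 * (\<theta> - of_nat n + 1)) (pCons 0 (pderiv f)) - smult (4 * of_nat n * \<theta>) f = 0"
    (is "?p = 0")
  proof (rule poly_eqI)
    fix k
    have "coeff ?p k = of_nat (k + 1) * (\<gamma> + of_nat k) * coeff f (k + 1)
            - 4 * (of_nat n - of_nat k) * (\<theta> + of_nat k) * coeff f k"
      by (auto simp: coeff_pCons coeff_pderiv algebra_simps split: nat.split)
    then show "coeff ?p k = coeff 0 k"
      using coeff_heun_reduced_poly_Suc[OF assms(1)] by (simp add: f_def)
  qed
  then have "poly ?p y = 0" by simp
  then show ?thesis by (simp add: algebra_simps)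
qed

text \<open>
  Here \<open>[:0, -1, 1:]\<close> is \<open>x\<^sup>2 - x\<close>. Multiplying the Heun equation by \<open>y = x\<^sup>2 - x\<close> and using
  \<open>(2x - 1)\<^sup>2 = 4y + 1\<close> gives the equation of \<open>heun_reduced_poly_ode\<close> at \<open>y\<close>.
\<close>

lemma local_heun_solution_pcompose:
  fixes \<theta> \<gamma> :: complex
  assumes "\<gamma> \<notin> \<int>\<^sub>\<le>\<^sub>0"
  shows "local_heun_solution (1/2) (- 2 * of_nat n * \<theta>) (- 2 * of_nat n) (2 * \<theta>) \<gamma> \<gamma>
           (poly (pcompose (heun_reduced_poly n \<theta> \<gamma>) [:0, -1, 1:]))"
proof -
  define f where "f = heun_reduced_poly n \<theta> \<gamma>"
  define p where "p = pcompose f [:0, -1, 1:]"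
  have deriv_poly: "deriv (poly r) = poly (pderiv r)" for r :: "complex poly"
    by (intro ext DERIV_imp_deriv poly_DERIV)
  have eq: "heun_equation_at (1/2) (- 2 * of_nat n * \<theta>) (- 2 * of_nat n) (2 * \<theta>) \<gamma> \<gamma> (poly p) x"
    if x: "x \<noteq> 0" "x \<noteq> 1" "x \<noteq> 1/2" for x
  proof -
    define y where "y = x * (x - 1)"
    define f0 f1 f2 where "f0 = poly f y" and "f1 = poly (pderiv f) y"
      and "f2 = poly (pderiv (pderiv f)) y"
    have y: "poly [:0, -1, 1:] x = y" by (simp add: y_def algebra_simps)
    have q: "pderiv [:0, -1, 1:] = [:-1, 2::complex:]" "pderiv [:-1, 2:] = [:2::complex:]"
      by (simp_all add: pderiv_pCons)
    have lin: "poly [:-1, 2:] x = 2 * x - 1" by simp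
    have "poly p x = f0"
      by (simp only: p_def poly_pcompose y f0_def)
    moreover have "deriv (poly p) x = f1 * (2 * x - 1)"
      by (simp only: p_def deriv_poly pderiv_pcompose q poly_mult poly_pcompose y lin f1_def)
    moreover have "deriv (deriv (poly p)) x = f2 * (2 * x - 1) ^ 2 + 2 * f1"
      by (simp only: p_def deriv_poly pderiv_pcompose pderiv_mult q poly_mult poly_add poly_pcompose
          y lin f1_def f2_def) (simp add: power2_eq_square)
    ultimately have p: "poly p x = f0" "deriv (poly p) x = f1 * (2 * x - 1)"
      "deriv (deriv (poly p)) x = f2 * (2 * x - 1) ^ 2 + 2 * f1" by blast+
    have nz: "x \<noteq> 0" "x - 1 \<noteq> 0" "2 * x - 1 \<noteq> 0" "y \<noteq> 0"
      using x by (auto simp: y_def field_simps)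
    have sq: "(2 * x - 1) ^ 2 = 4 * y + 1"
      by (simp add: y_def power2_eq_square algebra_simps)
    define \<epsilon> where "\<epsilon> = 2 * \<theta> - 2 * of_nat n + 1 - 2 * \<gamma>"
    have \<epsilon>: "heun_epsilon (- 2 * of_nat n) (2 * \<theta>) \<gamma> \<gamma> = \<epsilon>"
      by (simp add: heun_epsilon_def \<epsilon>_def)
    have h1: "\<gamma> / x + \<gamma> / (x - 1) = \<gamma> * (2 * x - 1) / y"
      using nz by (simp add: y_def field_simps)
    have h2: "\<epsilon> / (x - 1/2) = 2 * \<epsilon> / (2 * x - 1)"
      using nz x by (simp add: field_simps)
    have num: "(- 2 * of_nat n) * (2 * \<theta>) * x - (- 2 * of_nat n * \<theta>) = - 4 * of_nat n * \<theta> * (x - 1/2)"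
      by (simp add: algebra_simps)
    have h3: "((- 2 * of_nat n) * (2 * \<theta>) * x - (- 2 * of_nat n * \<theta>)) / (x * (x - 1) * (x - 1/2))
              = - 4 * of_nat n * \<theta> / y"
      unfolding num y_def using x by simp
    have "y * (deriv (deriv (poly p)) x
        + (\<gamma> / x + \<gamma> / (x - 1) + \<epsilon> / (x - 1/2)) * deriv (poly p) x
        + ((- 2 * of_nat n) * (2 * \<theta>) * x - (- 2 * of_nat n * \<theta>)) / (x * (x - 1) * (x - 1/2))
           * poly p x)
      = y * (f2 * (2 * x - 1) ^ 2 + 2 * f1) + (\<gamma> * (2 * x - 1) ^ 2 + 2 * \<epsilon> * y) * f1
        - 4 * of_nat n * \<theta> * f0"
      unfolding h1 h2 h3 p using nz by (simp add: field_simps power2_eq_square)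
    also have "\<dots> = y * (4 * y + 1) * f2 + (\<gamma> + 4 * (\<theta> - of_nat n + 1) * y) * f1
        - 4 * of_nat n * \<theta> * f0"
      unfolding sq \<epsilon>_def by (simp add: algebra_simps)
    also have "\<dots> = 0"
      unfolding f0_def f1_def f2_def f_def by (rule heun_reduced_poly_ode[OF assms])
    finally show ?thesis
      using nz(4) unfolding heun_equation_at_def \<epsilon> mult_eq_0_iff by blast
  qed
  have "poly p 0 = coeff f 0"
    by (simp add: p_def poly_pcompose poly_0_coeff_0)
  also have "\<dots> = 1" by (simp add: f_def coeff_heun_reduced_poly)
  finally have "poly p 0 = 1" .
  moreover have "eventually (\<lambda>x::complex. x \<noteq> c) (at 0)" for c
    by (rule eventually_neq_at_within)
  then have "eventually (\<lambda>x::complex. x \<noteq> 0 \<and> x \<noteq> 1 \<and> x \<noteq> 1/2) (at 0)"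
    by (intro eventually_conj)
  then have "\<forall>\<^sub>F x in at 0. heun_equation_at (1/2) (- 2 * of_nat n * \<theta>) (- 2 * of_nat n)
               (2 * \<theta>) \<gamma> \<gamma> (poly p) x"
    by (rule eventually_mono) (blast intro: eq)
  moreover have "poly p analytic_on {0}"
    by (rule has_fps_expansion_imp_analytic_0[of _ "fps_of_poly p"])
       (simp add: has_fps_expansion_def)
  ultimately show ?thesis
    unfolding p_def[unfolded f_def, symmetric] local_heun_solution_def by blast
qed

theorem theorem2p5:
  fixes n :: nat and \<theta> :: real and \<gamma> x :: complex
  assumes "\<gamma> \<notin> \<int>\<^sub>\<le>\<^sub>0"
  shows "Hl (1/2) (- 2 * of_nat n * of_real \<theta>) (- 2 * of_nat n) (2 * of_real \<theta>) \<gamma> \<gamma> x =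
    (\<Sum>k=0..n. 4 ^ k * of_nat (n choose k) *
       (pochhammer (of_real \<theta>) k / pochhammer \<gamma> k) * (x\<^sup>2 - x) ^ k)"
proof -
  have "Hl (1/2) (- 2 * of_nat n * of_real \<theta>) (- 2 * of_nat n) (2 * of_real \<theta>) \<gamma> \<gamma> x =
        poly (pcompose (heun_reduced_poly n (of_real \<theta>) \<gamma>) [:0, -1, 1:]) x"
    using assms by (intro Hl_poly local_heun_solution_pcompose) auto
  also have "\<dots> = poly (heun_reduced_poly n (of_real \<theta>) \<gamma>) (x\<^sup>2 - x)"
    by (simp add: poly_pcompose power2_eq_square algebra_simps)
  finally show ?thesis
    by (simp add: heun_reduced_poly_def poly_sum poly_monom)
qed

end
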